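(* Let $M>0$ and let $a:[0,+\infty)\to[0,+\infty)$ be an interaction function. If $\lim_{s\to+\infty}s\,a(s)=+\infty$, then there exists a real number $\mu>0$ and a set $$B:=\Big\{(x_i)_{i\in\{1,\dots,N\}}\in(\mathbb{R}^d)^N:\ \min_{i\neq j}\|x_i-x_j\|\leq\mu\Big\}$$ (called the basin of attraction) such that for any initial condition $x(0)$ and for any control $u\in U_M$, there exists a finite time $T>0$ such that $x(T)\in B$, where $x$ is the solution of $$\dot x_i=\frac1N\sum_{j\neq i}a(\|x_i-x_j\|)(x_j-x_i)+u_i,\quad i\in\{1,\dots,N\}.$$
   Context: $N\ge2$ agents, $x_i(t)\in\mathbb{R}^d$, $\|\cdot\|$ Euclidean norm. $U_M=\{u:\mathbb{R}^+\to(\mathbb{R}^d)^N\text{ measurable}:\sum_{i=1}^N\|u_i(t)\|\leq M\text{ for a.e. }t\}$. If $a$ is unbounded near $0$, the convention $a(0)=0$ is used in the differential equation and solutions are extended by continuity after collision times. *)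

theory Defs
  imports "HOL-Analysis.Analysis"
begin

text \<open>A configuration of \<open>N = CARD('n)\<close> agents in \<open>\<real>\<^sup>d\<close>, \<open>d = CARD('d)\<close>, is a vector of
  type \<open>(real^'d)^'n\<close>.\<close>

definition admissible_controls :: "real \<Rightarrow> (real \<Rightarrow> (real^'d)^'n) set" where
  "admissible_controls M =
     {u. u \<in> borel_measurable (lebesgue_on {0..}) \<and>
         (AE t in lebesgue_on {0..}. (\<Sum>i\<in>UNIV. norm (u t $ i)) \<le> M)}"

text \<open>The value \<open>a 0\<close> only ever multiplies a zero vector here, so the convention \<open>a 0 = 0\<close> for
  an interaction function that is unbounded near \<open>0\<close> needs no separate treatment.\<close>

definition velocity ::
  "(real \<Rightarrow> real) \<Rightarrow> (real^'d)^'n \<Rightarrow> (real^'d)^'n \<Rightarrow> 'n \<Rightarrow> real^'d" where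
  "velocity a y v i =
     (1 / real CARD('n)) *\<^sub>R
       (\<Sum>j\<in>UNIV - {i}. a (norm (y $ i - y $ j)) *\<^sub>R (y $ j - y $ i)) + v $ i"

definition bounded_near_zero :: "(real \<Rightarrow> real) \<Rightarrow> bool" where
  "bounded_near_zero a \<longleftrightarrow> (\<exists>\<delta>>0. \<exists>C. \<forall>s\<in>{0<..\<delta>}. a s \<le> C)"

definition collision_free_on :: "(real \<Rightarrow> (real^'d)^'n) \<Rightarrow> 'n \<Rightarrow> real set \<Rightarrow> bool" where
  "collision_free_on x i S \<longleftrightarrow> (\<forall>r\<in>S. \<forall>j. j \<noteq> i \<longrightarrow> x r $ j \<noteq> x r $ i)"

text \<open>Solutions are meant in the sense of Caratheodory, written as an integral equation (the
  control is only measurable). If \<open>a\<close> is bounded near \<open>0\<close>, the equation holds on all of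
  \<open>{0..}\<close>. If \<open>a\<close> is unbounded near \<open>0\<close>, the trajectories are continuous through
  collisions, and the equation of agent \<open>i\<close> is imposed exactly on those time intervals on which
  \<open>i\<close> does not coincide with another agent: at a collision the right-hand side is singular, and
  with the convention \<open>a 0 = 0\<close> an integral equation across the collision can fail to have any
  solution.\<close>

definition solution ::
  "(real \<Rightarrow> real) \<Rightarrow> (real \<Rightarrow> (real^'d)^'n) \<Rightarrow> (real^'d)^'n \<Rightarrow> (real \<Rightarrow> (real^'d)^'n) \<Rightarrow> bool"
where
  "solution a u x0 x \<longleftrightarrow>
     continuous_on {0..} x \<and> x 0 = x0 \<and>
     (\<forall>i s t. 0 \<le> s \<longrightarrow> s \<le> t \<longrightarrow> bounded_near_zero a \<or> collision_free_on x i {s..t} \<longrightarrow>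
        (\<lambda>r. velocity a (x r) (u r) i) absolutely_integrable_on {s..t} \<and>
        x t $ i = x s $ i + integral {s..t} (\<lambda>r. velocity a (x r) (u r) i))"

definition basin :: "real \<Rightarrow> ((real^'d)^'n) set" where
  "basin \<mu> = {y. Min {norm (y $ i - y $ j) | i j. i \<noteq> j} \<le> \<mu>}"

end

theory Submission
  imports Defs
begin

text \<open>If the basin is never reached, all pairwise distances exceed \<open>\<mu>\<close>. In the evolution of
  \<open>W = (\<Sum>i j. \<parallel>x\<^sub>i - x\<^sub>j\<parallel>\<^sup>2)\<close> the attraction contributes
  \<open>-2 (\<Sum>i j. a(\<parallel>x\<^sub>i - x\<^sub>j\<parallel>) \<parallel>x\<^sub>i - x\<^sub>j\<parallel>\<^sup>2)\<close> and the control at most \<open>2 M (\<Sum>i j. \<parallel>x\<^sub>i - x\<^sub>j\<parallel>)\<close>.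
  When \<open>s a(s) \<ge> M + 1\<close> for all \<open>s \<ge> \<mu>\<close>, this gives \<open>W' \<le> -2 \<mu>\<close> almost everywhere, so \<open>W\<close>
  would eventually become negative.\<close>

section \<open>Squared norms along curves with an integrable derivative\<close>

text \<open>Increments telescope along a uniform partition finer than \<open>\<delta>\<close>, so
  the local bounds add up. Below, \<open>\<delta>\<close> comes from uniform continuity and
  \<open>G\<close> is a multiple of the integral of a norm.\<close>

lemma local_increment_bound_imp_global:
  fixes h :: "real \<Rightarrow> 'a::real_normed_vector" and G :: "real \<Rightarrow> real"
  assumes "a \<le> b" "0 < \<delta>"
    and loc: "\<And>s t. \<lbrakk>a \<le> s; s \<le> t; t \<le> b; t - s < \<delta>\<rbrakk> \<Longrightarrow> norm (h t - h s) \<le> G t - G s"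
  shows "norm (h b - h a) \<le> G b - G a"
proof -
  obtain n :: nat where n: "(b - a) / \<delta> < real n"
    using reals_Archimedean2 by blast
  have "0 \<le> (b - a) / \<delta>"
    using assms by simp
  then have n0: "0 < real n"
    using n by linarith
  define d where "d = (b - a) / real n"
  have d: "0 \<le> d" "d < \<delta>"
    using n n0 assms by (auto simp: d_def field_simps)
  have "norm (h (a + real k * d) - h a) \<le> G (a + real k * d) - G a" if "k \<le> n" for k
    using that
  proof (induction k)
    case (Suc k)
    have "real (Suc k) * d \<le> real n * d"
      using Suc.prems d by (intro mult_right_mono) auto
    then have le: "a + real (Suc k) * d \<le> b"
      using n0 by (simp add: d_def)
    have "norm (h (a + real (Suc k) * d) - h (a + real k * d))
        \<le> G (a + real (Suc k) * d) - G (a + real k * d)"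
      using le d by (intro loc) (auto simp: algebra_simps)
    moreover have "norm (h (a + real k * d) - h a) \<le> G (a + real k * d) - G a"
      using Suc by simp
    ultimately show ?case
      using norm_triangle_ineq[of "h (a + real (Suc k) * d) - h (a + real k * d)"
          "h (a + real k * d) - h a"] by simp
  qed simp
  from this[of n] show ?thesis
    using n0 by (simp add: d_def)
qed

text \<open>The integrand \<open>g\<close> is only integrable, so instead of differentiating one uses
  \<open>\<parallel>f t\<parallel>\<^sup>2 - \<parallel>f s\<parallel>\<^sup>2 = (\<integral>\<^sub>s\<^sup>t (f t + f s) \<bullet> g)\<close> and the uniform continuity of \<open>f\<close>.\<close>

lemma has_integral_inner_indefinite_integral:
  fixes f g :: "real \<Rightarrow> 'a::euclidean_space"
  assumes "a \<le> b" and g: "g absolutely_integrable_on {a..b}"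
    and f: "\<And>t. t \<in> {a..b} \<Longrightarrow> f t = f a + integral {a..t} g"
  shows "((\<lambda>r. 2 * (f r \<bullet> g r)) has_integral ((norm (f b))\<^sup>2 - (norm (f a))\<^sup>2)) {a..b}"
proof -
  have gi: "g integrable_on {a..b}"
    and ngi: "(\<lambda>r. norm (g r)) integrable_on {a..b}"
    using g absolutely_integrable_on_def by blast+
  have cf: "continuous_on {a..b} f"
  proof -
    have "continuous_on {a..b} (\<lambda>t. f a + integral {a..t} g)"
      by (intro continuous_intros indefinite_integral_continuous_1 gi)
    then show ?thesis
      by (rule continuous_on_eq) (rule f[symmetric])
  qed
  \<comment> \<open>A bounded measurable factor preserves absolute integrability of
    \<open>g\<close>.\<close>
  have fg: "(\<lambda>r. f r \<bullet> g r) absolutely_integrable_on {a..b}"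
  proof (rule absolutely_integrable_bounded_measurable_product[where h = "(\<bullet>)" and f = f])
    show "bilinear ((\<bullet>) :: 'a \<Rightarrow> 'a \<Rightarrow> real)"
      by (simp add: bilinear_conv_bounded_bilinear bounded_bilinear_inner)
    show "f \<in> borel_measurable (lebesgue_on {a..b})"
      using cf by (intro continuous_imp_measurable_on_sets_lebesgue) auto
    show "bounded (f ` {a..b})"
      using cf by (intro compact_imp_bounded compact_continuous_image) auto
  qed (use g in auto)
  define k where "k = (\<lambda>r. 2 * (f r \<bullet> g r))"
  have k: "k integrable_on {a..b}"
    unfolding k_def using fg absolutely_integrable_on_def
    by (metis integrable_on_mult_right)
  have sub: "{s..t} \<subseteq> {a..b}" if "a \<le> s" "t \<le> b" for s t
    using that by auto
  have increment: "integral {a..t} q - integral {a..s} q = integral {s..t} q"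
    if "q integrable_on {a..b}" "a \<le> s" "s \<le> t" "t \<le> b" for q :: "real \<Rightarrow> 'c::euclidean_space" and s t
  proof -
    have "q integrable_on {a..t}"
      using that by (intro integrable_subinterval_real[OF that(1)]) auto
    then show ?thesis
      using Henstock_Kurzweil_Integration.integral_combine[of a s t q] that by (simp add: algebra_simps)
  qed
  \<comment> \<open>\<open>h\<close> is the defect of the claimed identity, so the goal is
    \<open>h b = h a\<close>. Its increments over short intervals will be at most \<open>e\<close>
    times those of \<open>G\<close>, for arbitrary \<open>e > 0\<close>.\<close>
  define h where "h t = (norm (f t))\<^sup>2 - integral {a..t} k" for t
  define G where "G t = integral {a..t} (\<lambda>r. norm (g r))" for t
  have "norm (h b - h a) \<le> e * G b" if "e > 0" for e
  proof -
    have "uniformly_continuous_on {a..b} f"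
      using cf by (intro compact_uniformly_continuous) auto
    then obtain \<delta> where "\<delta> > 0" and \<delta>:
      "\<And>x y. \<lbrakk>x \<in> {a..b}; y \<in> {a..b}; dist x y < \<delta>\<rbrakk> \<Longrightarrow> dist (f x) (f y) < e / 2"
      unfolding uniformly_continuous_on_def using \<open>e > 0\<close> by (metis half_gt_zero)
    have "norm (h b - h a) \<le> e * G b - e * G a"
    proof (rule local_increment_bound_imp_global[OF \<open>a \<le> b\<close> \<open>\<delta> > 0\<close>])
      fix s t assume st: "a \<le> s" "s \<le> t" "t \<le> b" "t - s < \<delta>"
      have gst: "g integrable_on {s..t}" and kst: "k integrable_on {s..t}"
        and nst: "(\<lambda>r. norm (g r)) integrable_on {s..t}"
        using st gi k ngi by (auto intro: integrable_subinterval_real)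
      have "f t - f s = integral {s..t} g"
        using f[of t] f[of s] st increment[OF gi, of s t] by simp
      moreover have "(norm (f t))\<^sup>2 - (norm (f s))\<^sup>2 = (f t + f s) \<bullet> (f t - f s)"
        by (simp add: power2_norm_eq_inner inner_commute algebra_simps)
      ultimately have "((\<lambda>r. (f t + f s) \<bullet> g r) has_integral (norm (f t))\<^sup>2 - (norm (f s))\<^sup>2) {s..t}"
        using has_integral_linear[OF integrable_integral[OF gst] bounded_linear_inner_right[of "f t + f s"]]
        by (simp add: o_def)
      from has_integral_diff[OF this integrable_integral[OF kst]]
      have "((\<lambda>r. (f t + f s) \<bullet> g r - k r) has_integral (h t - h s)) {s..t}"
        unfolding increment[OF k st(1-3), symmetric] by (simp add: h_def algebra_simps)
      then have hts: "integral {s..t} (\<lambda>r. (f t + f s) \<bullet> g r - k r) = h t - h s"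
        and hint: "(\<lambda>r. (f t + f s) \<bullet> g r - k r) integrable_on {s..t}"
        by auto
      have "norm (integral {s..t} (\<lambda>r. (f t + f s) \<bullet> g r - k r)) \<le> integral {s..t} (\<lambda>r. e * norm (g r))"
      proof (rule integral_norm_bound_integral[OF hint])
        show "(\<lambda>r. e * norm (g r)) integrable_on {s..t}"
          using nst by (rule integrable_on_mult_right)
        fix r assume r: "r \<in> {s..t}"
        have "norm (f t - f r) \<le> e / 2" "norm (f s - f r) \<le> e / 2"
          using \<delta>[of t r] \<delta>[of s r] r st by (auto simp: dist_norm)
        then have le: "norm ((f t - f r) + (f s - f r)) \<le> e"
          using norm_triangle_ineq[of "f t - f r" "f s - f r"] by linarith
        \<comment> \<open>The factor 2 in \<open>k\<close> splits as \<open>f r + f r\<close>; each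
          copy is paired with one endpoint value, which lies within \<open>e / 2\<close> of
          it.\<close>
        have "(f t + f s) \<bullet> g r - k r = ((f t - f r) + (f s - f r)) \<bullet> g r"
          by (simp add: k_def algebra_simps)
        also have "norm \<dots> \<le> norm ((f t - f r) + (f s - f r)) * norm (g r)"
          by (simp add: Cauchy_Schwarz_ineq2)
        also have "\<dots> \<le> e * norm (g r)"
          using le by (intro mult_right_mono) auto
        finally show "norm ((f t + f s) \<bullet> g r - k r) \<le> e * norm (g r)" .
      qed
      also have "\<dots> = e * G t - e * G s"
        using increment[OF ngi st(1-3)] by (simp add: G_def flip: right_diff_distrib)
      finally show "norm (h t - h s) \<le> e * G t - e * G s"
        unfolding hts .
    qed
    then show ?thesis
      by (simp add: G_def)
  qed
  then have "norm (h b - h a) \<le> e" if "e > 0" for e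
  proof -
    have "0 \<le> G b"
      unfolding G_def using ngi by (intro integral_nonneg) auto
    \<comment> \<open>The summand 1 keeps the denominator positive even when
      \<open>G b = 0\<close>.\<close>
    with \<open>e > 0\<close> have "e / (G b + 1) > 0" "e / (G b + 1) * G b \<le> e"
      by (auto simp: field_simps)
    then show ?thesis
      using \<open>\<And>e. e > 0 \<Longrightarrow> norm (h b - h a) \<le> e * G b\<close> by fastforce
  qed
  then have "h b = h a"
    using field_le_epsilon[of "norm (h b - h a)" 0] by simp
  then have "integral {a..b} k = (norm (f b))\<^sup>2 - (norm (f a))\<^sup>2"
    by (simp add: h_def)
  then show ?thesis
    using integrable_integral[OF k] by (simp add: k_def)
qed

section \<open>Dissipation by the interaction against the control\<close>

text \<open>Symmetric weights make the forces antisymmetric, so the \<open>w i\<close> sum to 0 and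
  the cross terms vanish. What remains is \<open>2 * real CARD('n)\<close> times the sum of
  \<open>y i \<bullet> w i\<close>; the cardinality cancels the averaging factor, and symmetrizing
  in \<open>i\<close> and \<open>j\<close> yields the squares.\<close>

lemma sum_inner_symmetric_interaction:
  fixes y :: "'n::finite \<Rightarrow> 'a::real_inner" and c :: "'n \<Rightarrow> 'n \<Rightarrow> real"
  assumes c: "\<And>i j. c i j = c j i"
    and w: "\<And>i. w i = (1 / real CARD('n)) *\<^sub>R (\<Sum>j\<in>UNIV. c i j *\<^sub>R (y j - y i))"
  shows "(\<Sum>i\<in>UNIV. \<Sum>j\<in>UNIV. (y i - y j) \<bullet> (w i - w j))
    = - (\<Sum>i\<in>UNIV. \<Sum>j\<in>UNIV. c i j * (norm (y i - y j))\<^sup>2)"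
proof -
  have swap: "(\<Sum>i\<in>UNIV. \<Sum>j\<in>UNIV. z i j) = (\<Sum>i\<in>UNIV. \<Sum>j\<in>UNIV. z j i)"
    for z :: "'n \<Rightarrow> 'n \<Rightarrow> 'b::comm_monoid_add"
    by (rule sum.swap)
  have "(\<Sum>i\<in>UNIV. \<Sum>j\<in>UNIV. c i j *\<^sub>R (y j - y i)) = - (\<Sum>i\<in>UNIV. \<Sum>j\<in>UNIV. c i j *\<^sub>R (y j - y i))"
    by (subst swap) (simp add: c algebra_simps flip: sum_negf)
  then have "2 *\<^sub>R (\<Sum>i\<in>UNIV. \<Sum>j\<in>UNIV. c i j *\<^sub>R (y j - y i)) = 0"
    unfolding scaleR_2 by (rule eq_neg_iff_add_eq_0[THEN iffD1])
  then have w0: "(\<Sum>i\<in>UNIV. w i) = 0"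
    by (simp add: w flip: scaleR_sum_right)
  have "(\<Sum>i\<in>UNIV. \<Sum>j\<in>UNIV. (y i - y j) \<bullet> (w i - w j))
      = 2 * real CARD('n) * (\<Sum>i\<in>UNIV. y i \<bullet> w i) - 2 * ((\<Sum>i\<in>UNIV. y i) \<bullet> (\<Sum>i\<in>UNIV. w i))"
    by (simp add: inner_diff_left inner_diff_right sum.distrib sum_subtractf inner_sum_left
        inner_sum_right sum_distrib_left sum_negf mult.assoc swap[of "\<lambda>i j. y j \<bullet> w i"])
  also have "\<dots> = 2 * (\<Sum>i\<in>UNIV. \<Sum>j\<in>UNIV. c i j * (y i \<bullet> (y j - y i)))"
    by (simp add: w0) (simp add: w inner_sum_right flip: sum_divide_distrib)
  also have "\<dots> = (\<Sum>i\<in>UNIV. \<Sum>j\<in>UNIV. c i j * (y i \<bullet> (y j - y i)))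
      + (\<Sum>i\<in>UNIV. \<Sum>j\<in>UNIV. c i j * (y j \<bullet> (y i - y j)))"
    using swap[of "\<lambda>i j. c i j * (y j \<bullet> (y i - y j))"] by (simp add: c)
  also have "\<dots> = - (\<Sum>i\<in>UNIV. \<Sum>j\<in>UNIV. c i j * (norm (y i - y j))\<^sup>2)"
    unfolding sum.distrib[symmetric] sum_negf[symmetric]
    by (intro sum.cong refl) (simp add: power2_norm_eq_inner inner_commute algebra_simps)
  finally show ?thesis .
qed

text \<open>For each pair at distance \<open>s\<close>, attraction gives at most
  \<open>-(M + 1) * s\<close> and the control at most \<open>M * s\<close>, leaving
  \<open>-s\<close>.\<close>

lemma sum_inner_velocity_le:
  fixes y v :: "(real^'d)^'n::finite"
  assumes n: "CARD('n) \<ge> 2" and "\<mu> > 0"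
    and a: "\<And>s. s \<ge> \<mu> \<Longrightarrow> M + 1 \<le> s * a s"
    and far: "\<And>i j. i \<noteq> j \<Longrightarrow> \<mu> \<le> norm (y $ i - y $ j)"
    and v: "(\<Sum>i\<in>UNIV. norm (v $ i)) \<le> M"
  shows "(\<Sum>i\<in>UNIV. \<Sum>j\<in>UNIV. (y $ i - y $ j) \<bullet> (velocity a y v i - velocity a y v j)) \<le> - \<mu>"
proof -
  define c where "c i j = a (norm (y $ i - y $ j))" for i j
  define w where "w i = (1 / real CARD('n)) *\<^sub>R (\<Sum>j\<in>UNIV. c i j *\<^sub>R (y $ j - y $ i))" for i
  have vel: "velocity a y v i = w i + v $ i" for i
  proof -
    \<comment> \<open>The term \<open>j = i\<close> is a multiple of the zero vector.\<close>
    have "(\<Sum>j\<in>UNIV. c i j *\<^sub>R (y $ j - y $ i)) = (\<Sum>j\<in>UNIV - {i}. c i j *\<^sub>R (y $ j - y $ i))"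
      by (simp add: sum.remove[of UNIV i])
    then show ?thesis
      by (simp add: velocity_def w_def c_def)
  qed
  have "(\<Sum>i\<in>UNIV. \<Sum>j\<in>UNIV. (y $ i - y $ j) \<bullet> (velocity a y v i - velocity a y v j))
    = (\<Sum>i\<in>UNIV. \<Sum>j\<in>UNIV. (y $ i - y $ j) \<bullet> (w i - w j))
      + (\<Sum>i\<in>UNIV. \<Sum>j\<in>UNIV. (y $ i - y $ j) \<bullet> (v $ i - v $ j))"
    unfolding vel sum.distrib[symmetric]
    by (intro sum.cong refl) (simp add: inner_add_right inner_diff_right)
  also have "(\<Sum>i\<in>UNIV. \<Sum>j\<in>UNIV. (y $ i - y $ j) \<bullet> (w i - w j))
      = - (\<Sum>i\<in>UNIV. \<Sum>j\<in>UNIV. c i j * (norm (y $ i - y $ j))\<^sup>2)"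
    by (rule sum_inner_symmetric_interaction) (auto simp: c_def w_def norm_minus_commute)
  also have "- (\<Sum>i\<in>UNIV. \<Sum>j\<in>UNIV. c i j * (norm (y $ i - y $ j))\<^sup>2)
      + (\<Sum>i\<in>UNIV. \<Sum>j\<in>UNIV. (y $ i - y $ j) \<bullet> (v $ i - v $ j))
      \<le> (\<Sum>i\<in>UNIV. \<Sum>j\<in>UNIV. - norm (y $ i - y $ j))"
    unfolding sum.distrib[symmetric] sum_negf[symmetric]
  proof (intro sum_mono)
    fix i j
    show "- (c i j * (norm (y $ i - y $ j))\<^sup>2) + (y $ i - y $ j) \<bullet> (v $ i - v $ j)
        \<le> - norm (y $ i - y $ j)"
    proof (cases "i = j")
      case False
      let ?s = "norm (y $ i - y $ j)"
      have "(M + 1) * ?s \<le> (?s * a ?s) * ?s"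
        using a[OF far[OF False]] by (intro mult_right_mono) auto
      then have attraction: "(M + 1) * ?s \<le> c i j * ?s\<^sup>2"
        by (simp add: c_def power2_eq_square mult_ac)
      \<comment> \<open>As \<open>i\<close> and \<open>j\<close> differ, their control norms are two
        separate terms of the total budget \<open>M\<close>, which gives \<open>M\<close> rather
        than \<open>2 * M\<close>.\<close>
      have "norm (v $ i - v $ j) \<le> (\<Sum>k\<in>{i, j}. norm (v $ k))"
        using False norm_triangle_ineq4[of "v $ i" "v $ j"] by simp
      also have "\<dots> \<le> (\<Sum>k\<in>UNIV. norm (v $ k))"
        by (intro sum_mono2) auto
      finally have "norm (v $ i - v $ j) \<le> M"
        using v by simp
      then have "?s * norm (v $ i - v $ j) \<le> ?s * M"
        by (intro mult_left_mono) auto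
      then have "(y $ i - y $ j) \<bullet> (v $ i - v $ j) \<le> ?s * M"
        using norm_cauchy_schwarz[of "y $ i - y $ j" "v $ i - v $ j"] by linarith
      then show ?thesis
        using attraction by (simp add: algebra_simps)
    qed simp
  qed
  also have "\<dots> \<le> - \<mu>"
  proof -
    \<comment> \<open>One pair of distinct agents already contributes \<open>\<mu>\<close> to the
      sum of distances.\<close>
    obtain i j :: 'n where "i \<noteq> j"
      using n card_le_Suc0_iff_eq[of "UNIV :: 'n set"] by fastforce
    then have "\<mu> \<le> norm (y $ i - y $ j)"
      by (rule far)
    also have "\<dots> \<le> (\<Sum>j\<in>UNIV. norm (y $ i - y $ j))"
      by (rule member_le_sum) auto
    also have "\<dots> \<le> (\<Sum>i\<in>UNIV. \<Sum>j\<in>UNIV. norm (y $ i - y $ j))"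
      by (rule member_le_sum) (auto intro: sum_nonneg)
    finally show ?thesis
      by (simp add: sum_negf)
  qed
  finally show ?thesis .
qed

section \<open>Decay outside the basin and the contradiction\<close>

lemma not_in_basin_imp_far:
  fixes y :: "(real^'d)^'n::finite"
  assumes "y \<notin> basin \<mu>" "i \<noteq> j"
  shows "\<mu> < norm (y $ i - y $ j)"
proof -
  let ?S = "{norm (y $ i - y $ j) | i j. i \<noteq> j}"
  have "?S \<subseteq> range (\<lambda>(i, j). norm (y $ i - y $ j))"
    by auto
  then have "finite ?S"
    by (rule finite_subset) simp
  moreover have "norm (y $ i - y $ j) \<in> ?S"
    using assms by auto
  ultimately have "Min ?S \<le> norm (y $ i - y $ j)"
    by (rule Min_le)
  then show ?thesis
    using assms by (simp add: basin_def)
qed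

text \<open>This is the differential inequality in integrated form. It starts at
  \<open>s > 0\<close> because avoidance is assumed at positive times only; agents may coincide at
  time 0.\<close>

lemma solution_avoiding_basin_decay:
  fixes x :: "real \<Rightarrow> (real^'d)^'n::finite"
  assumes sol: "solution a u x0 x" and u: "u \<in> admissible_controls M"
    and n: "CARD('n) \<ge> 2" and \<mu>: "\<mu> > 0"
    and a: "\<And>s. s \<ge> \<mu> \<Longrightarrow> M + 1 \<le> s * a s"
    and avoid: "\<And>t. t > 0 \<Longrightarrow> x t \<notin> basin \<mu>"
    and st: "0 < s" "s \<le> t"
  shows "(\<Sum>i\<in>UNIV. \<Sum>j\<in>UNIV. (norm (x t $ i - x t $ j))\<^sup>2)
    \<le> (\<Sum>i\<in>UNIV. \<Sum>j\<in>UNIV. (norm (x s $ i - x s $ j))\<^sup>2) - 2 * \<mu> * (t - s)"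
proof -
  define v where "v r i = velocity a (x r) (u r) i" for r i
  have far: "\<mu> < norm (x r $ i - x r $ j)" if "r > 0" "i \<noteq> j" for r i j
    using not_in_basin_imp_far[OF avoid] that by blast
  \<comment> \<open>Without collisions the integral equation holds for every agent, whether or not
    \<open>a\<close> is bounded near 0.\<close>
  have free: "collision_free_on x i {s..r}" for i r
    unfolding collision_free_on_def
  proof (intro ballI allI impI notI)
    fix q j assume "q \<in> {s..r}" "j \<noteq> i" "x q $ j = x q $ i"
    then show False
      using far[of q j i] st \<mu> by simp
  qed
  have int: "(\<lambda>r. v r i) absolutely_integrable_on {s..r}"
    and eq: "x r $ i = x s $ i + integral {s..r} (\<lambda>r. v r i)" if "s \<le> r" for i r
    using sol free[of i r] st that unfolding solution_def v_def by (auto dest!: spec)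
  have pair: "((\<lambda>r. 2 * ((x r $ i - x r $ j) \<bullet> (v r i - v r j))) has_integral
      ((norm (x t $ i - x t $ j))\<^sup>2 - (norm (x s $ i - x s $ j))\<^sup>2)) {s..t}" for i j
  proof (rule has_integral_inner_indefinite_integral[OF st(2)])
    show "(\<lambda>r. v r i - v r j) absolutely_integrable_on {s..t}"
      using int[OF st(2)] by (intro set_integral_diff)
    fix r assume "r \<in> {s..t}"
    then have "s \<le> r"
      by simp
    then show "x r $ i - x r $ j = x s $ i - x s $ j + integral {s..r} (\<lambda>r. v r i - v r j)"
      using eq[of r i] eq[of r j] int[of r i] int[of r j]
      by (simp add: Henstock_Kurzweil_Integration.integral_diff set_lebesgue_integral_eq_integral(1))
  qed
  define g where "g r = (\<Sum>i\<in>UNIV. \<Sum>j\<in>UNIV. 2 * ((x r $ i - x r $ j) \<bullet> (v r i - v r j)))" for r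
  have g: "(g has_integral (\<Sum>i\<in>UNIV. \<Sum>j\<in>UNIV.
      (norm (x t $ i - x t $ j))\<^sup>2 - (norm (x s $ i - x s $ j))\<^sup>2)) {s..t}"
    unfolding g_def by (intro has_integral_sum pair) auto
  have "AE r in lebesgue_on {0..}. (\<Sum>i\<in>UNIV. norm (u r $ i)) \<le> M"
    using u by (simp add: admissible_controls_def)
  then have "AE r in lebesgue. r \<in> {0..} \<longrightarrow> (\<Sum>i\<in>UNIV. norm (u r $ i)) \<le> M"
    by (subst (asm) AE_restrict_space_iff) auto
  then obtain N where N: "negligible N"
    and uN: "\<And>r. r \<notin> N \<Longrightarrow> r \<in> {0..} \<Longrightarrow> (\<Sum>i\<in>UNIV. norm (u r $ i)) \<le> M"
    unfolding eventually_ae_filter negligible_iff_null_sets by auto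
  have decay: "g r \<le> - 2 * \<mu>" if "r \<in> {s..t} - N" for r
  proof -
    have "g r = 2 * (\<Sum>i\<in>UNIV. \<Sum>j\<in>UNIV. (x r $ i - x r $ j) \<bullet> (v r i - v r j))"
      by (simp add: g_def sum_distrib_left)
    moreover have "(\<Sum>i\<in>UNIV. \<Sum>j\<in>UNIV. (x r $ i - x r $ j) \<bullet> (v r i - v r j)) \<le> - \<mu>"
      unfolding v_def
    proof (rule sum_inner_velocity_le[where M = M, OF n \<mu> a])
      show "\<mu> \<le> norm (x r $ i - x r $ j)" if "i \<noteq> j" for i j
        using far[of r i j] that \<open>r \<in> {s..t} - N\<close> st by simp
      show "(\<Sum>i\<in>UNIV. norm (u r $ i)) \<le> M"
        using uN[of r] \<open>r \<in> {s..t} - N\<close> st by simp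
    qed
    ultimately show ?thesis
      by simp
  qed
  \<comment> \<open>Resetting \<open>g\<close> on the null set \<open>N\<close> keeps the integral
    and makes the bound hold at every point of the interval.\<close>
  have "((\<lambda>r. if r \<in> N then - 2 * \<mu> else g r) has_integral (\<Sum>i\<in>UNIV. \<Sum>j\<in>UNIV.
      (norm (x t $ i - x t $ j))\<^sup>2 - (norm (x s $ i - x s $ j))\<^sup>2)) {s..t}"
    by (rule has_integral_spike[OF N _ g]) auto
  moreover have "((\<lambda>r. - 2 * \<mu>) has_integral (- 2 * \<mu>) * (t - s)) {s..t}"
    using has_integral_const_real[of "- 2 * \<mu>" s t] st by (simp add: mult.commute)
  ultimately have "(\<Sum>i\<in>UNIV. \<Sum>j\<in>UNIV.
      (norm (x t $ i - x t $ j))\<^sup>2 - (norm (x s $ i - x s $ j))\<^sup>2) \<le> (- 2 * \<mu>) * (t - s)"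
    by (rule has_integral_le) (use decay in auto)
  then show ?thesis
    by (simp add: sum_subtractf)
qed

theorem theorem1p6:
  fixes a :: "real \<Rightarrow> real" and M :: real
  assumes "CARD('n::finite) \<ge> 2"
    and "M > 0"
    and "\<And>s. s \<ge> 0 \<Longrightarrow> a s \<ge> 0"
    and "filterlim (\<lambda>s. s * a s) at_top at_top"
  shows "\<exists>\<mu>>0. \<forall>(x0 :: (real^'d)^'n). \<forall>u\<in>admissible_controls M. \<forall>x.
           solution a u x0 x \<longrightarrow> (\<exists>T>0. x T \<in> basin \<mu>)"
proof -
  obtain \<mu>0 where \<mu>0: "\<And>s. s \<ge> \<mu>0 \<Longrightarrow> M + 1 \<le> s * a s"
    using assms(4) unfolding filterlim_at_top eventually_at_top_linorder by blast
  \<comment> \<open>The maximum with 1 forces positivity. The radius depends on \<open>a\<close> and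
    \<open>M\<close> alone, hence is uniform in initial data and controls.\<close>
  define \<mu> where "\<mu> = max \<mu>0 1"
  have \<mu>: "\<mu> > 0" "\<And>s. s \<ge> \<mu> \<Longrightarrow> M + 1 \<le> s * a s"
    using \<mu>0 by (auto simp: \<mu>_def)
  have "\<exists>T>0. x T \<in> basin \<mu>"
    if u: "u \<in> admissible_controls M" and sol: "solution a u x0 x"
    for x0 :: "(real^'d)^'n" and u x
  proof (rule ccontr)
    assume "\<not> (\<exists>T>0. x T \<in> basin \<mu>)"
    then have avoid: "\<And>t. t > 0 \<Longrightarrow> x t \<notin> basin \<mu>"
      by blast
    define W where "W t = (\<Sum>i\<in>UNIV. \<Sum>j\<in>UNIV. (norm (x t $ i - x t $ j))\<^sup>2)" for t
    have W: "0 \<le> W t" for t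
      unfolding W_def by (intro sum_nonneg) auto
    \<comment> \<open>At this time the decay from time 1 brings the upper bound for \<open>W\<close>
      to exactly -1.\<close>
    define t where "t = 1 + (W 1 + 1) / (2 * \<mu>)"
    have "W t \<le> W 1 - 2 * \<mu> * (t - 1)"
      unfolding W_def using W[of 1] \<mu>
      by (intro solution_avoiding_basin_decay[OF sol u assms(1) \<mu> avoid]) (auto simp: t_def)
    also have "\<dots> = -1"
      using \<mu>(1) by (simp add: t_def)
    finally show False
      using W[of t] by simp
  qed
  then show ?thesis
    using \<mu>(1) by blast
qed

end
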